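(* For any $A$-labeled pair of twin binary search trees $(T_L, T_R)$ as input, the algorithm ExtractMin (resp. ExtractMax) computes the minimal (resp. maximal) word for the lexicographic order of the $\equiv_{\mathrm{B}}$-equivalence class encoded by $(T_L, T_R)$. Moreover, if $(T_L, T_R)$ is labeled by a permutation, the computed word is the minimal (resp. maximal) permutation for the permutohedron order of its $\equiv_{\mathrm{B}}$-equivalence class.
   Context: $A = \{a_1 < a_2 < \cdots\}$ is a totally ordered infinite alphabet and $A^*$ is the free monoid of words on $A$. The Baxter congruence $\equiv_{\mathrm{B}}$ is the smallest congruence (equivalence relation compatible with concatenation) on $A^*$ such that, for all words $u, v$ and letters $a,b,c,d$: $\; c\,u\,a d\,v\,b \equiv_{\mathrm{B}} c\,u\,d a\,v\,b$ whenever $a \leq b < c \leq d$, and $\; b\,u\,d a\,v\,c \equiv_{\mathrm{B}} b\,u\,a d\,v\,c$ whenever $a < b \leq c < d$. Permutations of size $n$ are words of length $n$ without repetition on the first $n$ letters of $A$ (identified with $1,\dots,n$). The permutohedron order on permutations of size $n$ is the partial order in which $\sigma$ is covered by $\nu$ iff $\sigma = u\,ab\,v$ and $\nu = u\,ba\,v$ for some words $u,v$ and letters $a<b$. A binary tree is either a leaf (empty tree) or a node with a left and a right binary subtree. The $i$-th node is the $i$-th node visited by the inorder traversal (left subtree, root, right subtree); the inorder reading of a labeled tree is the word of labels in this order. The canopy of a binary tree with $n$ nodes is the word of length $n-1$ obtained by reading its leaves from left to right except the first and the last, writing $0$ if the leaf is a right child and $1$ if it is a left child. Two binary trees $(T_L,T_R)$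 with $n$ nodes form a pair of twin binary trees if their canopies differ at every position $1\le i\le n-1$. A tree labeled by $A$ is a right (resp. left) binary search tree if for each node labeled $b$, all labels $a$ in its left subtree and $c$ in its right subtree satisfy $a \leq b < c$ (resp. $a < b \leq c$). A pair of twin binary search trees is an $A$-labeled pair of twin binary trees $(T_L,T_R)$ with $T_L$ a left binary search tree, $T_R$ a right binary search tree, and both having the same inorder reading. It is labeled by a permutation if the labels of each tree with $n$ nodes are $1,\dots,n$, each used once. Leaf insertion of a letter $a$ into a right (resp. left) binary search tree: in the empty tree, create a node labeled $a$; otherwise, with $b$ the root label, insert recursively into the left subtree if $a \leq b$ (resp. $a<b$), and into the right subtree otherwise. For $u \in A^*$, $\mathsf{P}(u) = (T_L,T_R)$ where $T_L$ (resp. $T_R$) is the left (resp. right) binary search tree obtained by leaf inserting the letters of $u$ from left to right (resp. right to left). The class encoded by $(T_L,T_R)$ is the $\equiv_{\mathrm{B}}$-equivalence class of the words $u$ with $\mathsf{P}(u) = (T_L,T_R)$. Algorithm ExtractMin, on input $(T_L,T_R)$ (throughout the execution, nodes are designated by their inorder indices in the input trees): (1) let $u$ be the empty word. (2) Let $F := T_L$, seen as a rooted forest. (3) While $F$ and $T_R$ are not empty: (a) let $i$ be the smallest index such that the $i$-th node is a root of $F$ and the $i$-th node of $T_R$ has no child; (b) let $a$ be the label of the $i$-th node of $T_L$; (c) set $u := u a$; (d) suppress the $i$-th node of $F$ (the subtrees below it become trees of the forest) and the $i$-th node of $T_R$. (4) Return $u$. Algorithm ExtractMax is the variant in which in step (a)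 the greatest such index is chosen instead of the smallest. *)

theory Defs
  imports "HOL-Library.Tree"
begin

section \<open>The alphabet, the Baxter congruence and the permutohedron\<close>

text \<open>The letters of the alphabet are the elements of the type \<open>'a\<close>; \<open>A i\<close> is the \<open>i\<close>-th letter
  \<open>a\<^sub>i\<close> for \<open>i \<ge> 1\<close> (the value \<open>A 0\<close> plays no role).\<close>

definition alphabet :: "(nat \<Rightarrow> 'a::linorder) \<Rightarrow> bool" where
  "alphabet A \<longleftrightarrow> strict_mono_on {1..} A \<and> A ` {1..} = UNIV"

inductive baxter :: "'a::linorder list \<Rightarrow> 'a list \<Rightarrow> bool"  (infix \<open>\<equiv>\<^sub>B\<close> 50) where
  baxter_refl: "u \<equiv>\<^sub>B u"
| baxter_sym: "u \<equiv>\<^sub>B v \<Longrightarrow> v \<equiv>\<^sub>B u"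
| baxter_trans: "u \<equiv>\<^sub>B v \<Longrightarrow> v \<equiv>\<^sub>B w \<Longrightarrow> u \<equiv>\<^sub>B w"
| baxter_append: "u \<equiv>\<^sub>B u' \<Longrightarrow> v \<equiv>\<^sub>B v' \<Longrightarrow> u @ v \<equiv>\<^sub>B u' @ v'"
| baxter_gen1: "a \<le> b \<Longrightarrow> b < c \<Longrightarrow> c \<le> d \<Longrightarrow>
    [c] @ u @ [a, d] @ v @ [b] \<equiv>\<^sub>B [c] @ u @ [d, a] @ v @ [b]"
| baxter_gen2: "a < b \<Longrightarrow> b \<le> c \<Longrightarrow> c < d \<Longrightarrow>
    [b] @ u @ [d, a] @ v @ [c] \<equiv>\<^sub>B [b] @ u @ [a, d] @ v @ [c]"

definition is_permutation :: "(nat \<Rightarrow> 'a) \<Rightarrow> nat \<Rightarrow> 'a list \<Rightarrow> bool" where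
  "is_permutation A n \<sigma> \<longleftrightarrow> length \<sigma> = n \<and> distinct \<sigma> \<and> set \<sigma> \<subseteq> A ` {1..n}"

definition permutohedron_covered ::
    "(nat \<Rightarrow> 'a::linorder) \<Rightarrow> nat \<Rightarrow> 'a list \<Rightarrow> 'a list \<Rightarrow> bool" where
  "permutohedron_covered A n \<sigma> \<nu> \<longleftrightarrow>
     is_permutation A n \<sigma> \<and> is_permutation A n \<nu> \<and>
     (\<exists>u v a b. a < b \<and> \<sigma> = u @ [a, b] @ v \<and> \<nu> = u @ [b, a] @ v)"

definition permutohedron_le ::
    "(nat \<Rightarrow> 'a::linorder) \<Rightarrow> nat \<Rightarrow> 'a list \<Rightarrow> 'a list \<Rightarrow> bool" where
  "permutohedron_le A n = (permutohedron_covered A n)\<^sup>*\<^sup>*"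

definition is_least :: "('b \<Rightarrow> 'b \<Rightarrow> bool) \<Rightarrow> 'b set \<Rightarrow> 'b \<Rightarrow> bool" where
  "is_least le C w \<longleftrightarrow> w \<in> C \<and> (\<forall>v\<in>C. le w v)"

definition is_greatest :: "('b \<Rightarrow> 'b \<Rightarrow> bool) \<Rightarrow> 'b set \<Rightarrow> 'b \<Rightarrow> bool" where
  "is_greatest le C w \<longleftrightarrow> w \<in> C \<and> (\<forall>v\<in>C. le v w)"

section \<open>Pairs of twin binary search trees\<close>

text \<open>\<open>leaf_sides d t\<close> lists the leaves of \<open>t\<close> from left to right, a right child being written \<open>0\<close>
  and a left child \<open>1\<close>; \<open>d\<close> is written if \<open>t\<close> is itself a leaf.\<close>

fun leaf_sides :: "nat \<Rightarrow> 'a tree \<Rightarrow> nat list" where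
  "leaf_sides d Leaf = [d]"
| "leaf_sides d (Node l x r) = leaf_sides 1 l @ leaf_sides 0 r"

definition canopy :: "'a tree \<Rightarrow> nat list" where
  "canopy t = butlast (tl (leaf_sides 0 t))"

definition twin_trees :: "'a tree \<Rightarrow> 'a tree \<Rightarrow> bool" where
  "twin_trees TL TR \<longleftrightarrow> size TL = size TR \<and> list_all2 (\<noteq>) (canopy TL) (canopy TR)"

fun left_bst :: "'a::linorder tree \<Rightarrow> bool" where
  "left_bst Leaf \<longleftrightarrow> True"
| "left_bst (Node l b r) \<longleftrightarrow>
     left_bst l \<and> left_bst r \<and> (\<forall>a\<in>set_tree l. a < b) \<and> (\<forall>c\<in>set_tree r. b \<le> c)"

fun right_bst :: "'a::linorder tree \<Rightarrow> bool" where
  "right_bst Leaf \<longleftrightarrow> True"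
| "right_bst (Node l b r) \<longleftrightarrow>
     right_bst l \<and> right_bst r \<and> (\<forall>a\<in>set_tree l. a \<le> b) \<and> (\<forall>c\<in>set_tree r. b < c)"

definition twin_bst :: "'a::linorder tree \<Rightarrow> 'a tree \<Rightarrow> bool" where
  "twin_bst TL TR \<longleftrightarrow>
     twin_trees TL TR \<and> left_bst TL \<and> right_bst TR \<and> inorder TL = inorder TR"

definition labeled_by_permutation :: "(nat \<Rightarrow> 'a) \<Rightarrow> 'a tree \<Rightarrow> 'a tree \<Rightarrow> bool" where
  "labeled_by_permutation A TL TR \<longleftrightarrow>
     is_permutation A (size TL) (inorder TL) \<and> is_permutation A (size TR) (inorder TR)"

section \<open>The P-symbol and the class encoded by a pair of trees\<close>

fun left_insert :: "'a::linorder \<Rightarrow> 'a tree \<Rightarrow> 'a tree" where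
  "left_insert a Leaf = Node Leaf a Leaf"
| "left_insert a (Node l b r) =
     (if a < b then Node (left_insert a l) b r else Node l b (left_insert a r))"

fun right_insert :: "'a::linorder \<Rightarrow> 'a tree \<Rightarrow> 'a tree" where
  "right_insert a Leaf = Node Leaf a Leaf"
| "right_insert a (Node l b r) =
     (if a \<le> b then Node (right_insert a l) b r else Node l b (right_insert a r))"

definition P_symbol :: "'a::linorder list \<Rightarrow> 'a tree \<times> 'a tree" where
  "P_symbol u = (fold left_insert u Leaf, foldr right_insert u Leaf)"

definition encoded_class :: "'a::linorder tree \<Rightarrow> 'a tree \<Rightarrow> 'a list set" where
  "encoded_class TL TR = (THE C. \<exists>u. P_symbol u = (TL, TR) \<and> C = {v. u \<equiv>\<^sub>B v})"

section \<open>The algorithms ExtractMin and ExtractMax\<close>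

text \<open>The algorithms run on copies of the trees in which the label of every node is replaced by its
  inorder index in the input tree, counted from \<open>1\<close>.  Forests are lists of nonempty trees.\<close>

fun index_from :: "nat \<Rightarrow> 'a tree \<Rightarrow> nat tree" where
  "index_from k Leaf = Leaf"
| "index_from k (Node l x r) =
     Node (index_from k l) (k + size l) (index_from (k + size l + 1) r)"

definition forest :: "'a tree list \<Rightarrow> 'a tree list" where
  "forest ts = filter (\<lambda>t. t \<noteq> Leaf) ts"

fun suppress_if_root :: "nat \<Rightarrow> nat tree \<Rightarrow> nat tree list" where
  "suppress_if_root i Leaf = []"
| "suppress_if_root i (Node l j r) = (if j = i then forest [l, r] else [Node l j r])"

definition suppress_root :: "nat \<Rightarrow> nat tree list \<Rightarrow> nat tree list" where
  "suppress_root i F = concat (map (suppress_if_root i) F)"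

fun suppress_childless :: "nat \<Rightarrow> nat tree \<Rightarrow> nat tree" where
  "suppress_childless i Leaf = Leaf"
| "suppress_childless i (Node l j r) =
     (if j = i \<and> l = Leaf \<and> r = Leaf then Leaf
      else Node (suppress_childless i l) j (suppress_childless i r))"

definition candidates :: "nat tree list \<Rightarrow> nat tree \<Rightarrow> nat set" where
  "candidates F T = {i. (\<exists>l r. Node l i r \<in> set F) \<and> Node Leaf i Leaf \<in> subtrees T}"

text \<open>The result \<open>None\<close> means that the execution gets stuck because step (a) has no candidate index.
  The argument \<open>lab\<close> is the inorder reading of the input tree \<open>T\<^sub>L\<close>.\<close>

partial_function (option) extract_loop ::
    "(nat set \<Rightarrow> nat) \<Rightarrow> 'a list \<Rightarrow> 'a list \<Rightarrow> nat tree list \<Rightarrow> nat tree \<Rightarrow> 'a list option" where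
  "extract_loop pick lab u F T =
     (if F = [] \<or> T = Leaf then Some u
      else if candidates F T = {} then None
      else let i = pick (candidates F T)
        in extract_loop pick lab (u @ [lab ! (i - 1)]) (suppress_root i F) (suppress_childless i T))"

definition extract_min :: "'a tree \<Rightarrow> 'a tree \<Rightarrow> 'a list option" where
  "extract_min TL TR = extract_loop Min (inorder TL) [] (forest [index_from 1 TL]) (index_from 1 TR)"

definition extract_max :: "'a tree \<Rightarrow> 'a tree \<Rightarrow> 'a list option" where
  "extract_max TL TR = extract_loop Max (inorder TL) [] (forest [index_from 1 TL]) (index_from 1 TR)"

end

theory Submission
  imports Defs "HOL-Library.Multiset"
begin

text \<open>Two adjacent letters may be exchanged by \<open>\<equiv>\<^sub>B\<close> iff a letter before them separates them in
  the left tree and a letter after them separates them in the right tree. If \<open>v\<close> and \<open>w\<close> have the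
  same P-symbol and \<open>w\<close> is lexicographically smaller, then some such exchange at a descent of \<open>v\<close> is
  possible. Descending from every word, one finds that the classes are the fibres of the
  P-symbol and that a lexicographically least word is also least for the permutohedron order.

  The words with a given P-symbol are those read off by the algorithm under arbitrary choices of
  the index in step (a). Two eligible indices have different labels, so the greedy choice gives the
  lexicographically extremal word. The algorithm never gets stuck because the sides of the leaves of
  \<open>T\<^sub>R\<close>, which differ from those of the forest inside each of its trees, begin with \<open>1\<close> and end
  with \<open>0\<close>.\<close>

section \<open>Trees of words\<close>

definition left_tree :: "'a::linorder list \<Rightarrow> 'a tree" where
  "left_tree u = fold left_insert u Leaf"

definition right_tree :: "'a::linorder list \<Rightarrow> 'a tree" where
  "right_tree u = foldr right_insert u Leaf"

lemma P_symbol_eq_iff: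
  "P_symbol u = (TL, TR) \<longleftrightarrow> left_tree u = TL \<and> right_tree u = TR"
  by (simp add: P_symbol_def left_tree_def right_tree_def)

lemma left_tree_Nil [simp]: "left_tree [] = Leaf"
  and right_tree_Nil [simp]: "right_tree [] = Leaf"
  by (simp_all add: left_tree_def right_tree_def)

text \<open>The letter inserted first stays the root, and every later letter is sent to one of its
  sides, the order within each side being kept. Insertion thus becomes a recursion on words.\<close>

lemma left_tree_Cons:
  "left_tree (x # u) =
     Node (left_tree (filter (\<lambda>y. y < x) u)) x (left_tree (filter (\<lambda>y. x \<le> y) u))"
proof -
  have "fold left_insert u (Node l x r) =
      Node (fold left_insert (filter (\<lambda>y. y < x) u) l) x
           (fold left_insert (filter (\<lambda>y. x \<le> y) u) r)" for l r
    by (induction u arbitrary: l r) auto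
  then show ?thesis by (simp add: left_tree_def)
qed

lemma right_tree_Cons: "right_tree (x # u) = right_insert x (right_tree u)"
  by (simp add: right_tree_def)

text \<open>Letters are inserted from right to left here, so the last one is the root.\<close>

lemma right_tree_snoc:
  "right_tree (u @ [x]) =
     Node (right_tree (filter (\<lambda>y. y \<le> x) u)) x (right_tree (filter (\<lambda>y. x < y) u))"
proof -
  have "foldr right_insert u (Node l x r) =
      Node (foldr right_insert (filter (\<lambda>y. y \<le> x) u) l) x
           (foldr right_insert (filter (\<lambda>y. x < y) u) r)" for l r
    by (induction u arbitrary: l r) auto
  then show ?thesis by (simp add: right_tree_def)
qed

section \<open>Letters of the trees and the search tree property\<close>

lemma mset_left_insert [simp]:
  "mset (inorder (left_insert a t)) = add_mset a (mset (inorder t))"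
  by (induction t) auto

lemma mset_right_insert [simp]:
  "mset (inorder (right_insert a t)) = add_mset a (mset (inorder t))"
  by (induction t) auto

lemma mset_left_tree [simp]: "mset (inorder (left_tree u)) = mset u"
proof -
  have "mset (inorder (fold left_insert u t)) = mset u + mset (inorder t)" for t
    by (induction u arbitrary: t) auto
  then show ?thesis by (simp add: left_tree_def)
qed

lemma mset_right_tree [simp]: "mset (inorder (right_tree u)) = mset u"
  by (induction u) (simp_all add: right_tree_Cons)

lemma set_tree_left_insert [simp]: "set_tree (left_insert a t) = insert a (set_tree t)"
  by (induction t) auto

lemma set_tree_right_insert [simp]: "set_tree (right_insert a t) = insert a (set_tree t)"
  by (induction t) auto

lemma set_tree_left_tree [simp]: "set_tree (left_tree u) = set u"
  by (metis mset_left_tree set_inorder set_mset_mset)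

lemma set_tree_right_tree [simp]: "set_tree (right_tree u) = set u"
  by (metis mset_right_tree set_inorder set_mset_mset)

lemma left_bst_left_insert: "left_bst t \<Longrightarrow> left_bst (left_insert a t)"
  by (induction t) auto

lemma right_bst_right_insert: "right_bst t \<Longrightarrow> right_bst (right_insert a t)"
  by (induction t) auto

lemma left_bst_left_tree: "left_bst (left_tree u)"
proof -
  have "left_bst t \<Longrightarrow> left_bst (fold left_insert u t)" for t
    by (induction u arbitrary: t) (auto simp: left_bst_left_insert)
  then show ?thesis by (simp add: left_tree_def)
qed

lemma right_bst_right_tree: "right_bst (right_tree u)"
  by (induction u) (auto simp: right_tree_Cons right_bst_right_insert)

text \<open>As long as \<open>a\<close> and \<open>d\<close> take the same branch, the separator
  \<open>c\<close> lies in that branch as well. Hence they part at \<open>c\<close> at the latest,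
  and from there on the two insertions act on disjoint subtrees.\<close>

lemma left_insert_commute:
  assumes "left_bst t" "c \<in> set_tree t" "a < c" "c \<le> d"
  shows "left_insert a (left_insert d t) = left_insert d (left_insert a t)"
  using assms by (induction t) fastforce+

lemma right_insert_commute:
  assumes "right_bst t" "b \<in> set_tree t" "a \<le> b" "b < d"
  shows "right_insert a (right_insert d t) = right_insert d (right_insert a t)"
  using assms by (induction t) fastforce+

section \<open>The Baxter congruence and the P-symbol\<close>

text \<open>Both generating relations in one, oriented from ascent to descent: \<open>c\<close>
  separates \<open>a\<close> and \<open>d\<close> for left insertion, \<open>b\<close> for right
  insertion. Not comparing \<open>b\<close> with \<open>c\<close> is what merges the two
  relations.\<close>

definition flip :: "'a::linorder list \<Rightarrow> 'a list \<Rightarrow> bool" where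
  "flip v w \<longleftrightarrow> (\<exists>s a d t. v = s @ [a, d] @ t \<and> w = s @ [d, a] @ t \<and>
     (\<exists>c\<in>set s. a < c \<and> c \<le> d) \<and> (\<exists>b\<in>set t. a \<le> b \<and> b < d))"

lemma flip_P_symbol:
  assumes "flip v w"
  shows "P_symbol v = P_symbol w"
proof -
  obtain s a d t c b where *: "v = s @ [a, d] @ t" "w = s @ [d, a] @ t"
    "c \<in> set s" "a < c" "c \<le> d" "b \<in> set t" "a \<le> b" "b < d"
    using assms unfolding flip_def by auto
  have "left_insert d (left_insert a (left_tree s)) = left_insert a (left_insert d (left_tree s))"
    using left_insert_commute[of "left_tree s" c a d] * by (simp add: left_bst_left_tree)
  moreover have "right_insert a (right_insert d (right_tree t)) =
      right_insert d (right_insert a (right_tree t))"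
    using right_insert_commute[of "right_tree t" b a d] * by (simp add: right_bst_right_tree)
  ultimately show ?thesis
    by (simp add: * P_symbol_def left_tree_def right_tree_def)
qed

lemma flip_context: "flip v w \<Longrightarrow> flip (x @ v @ y) (x @ w @ y)"
proof -
  assume "flip v w"
  then obtain s a d t where *: "v = s @ [a, d] @ t" "w = s @ [d, a] @ t"
    "\<exists>c\<in>set s. a < c \<and> c \<le> d" "\<exists>b\<in>set t. a \<le> b \<and> b < d"
    unfolding flip_def by blast
  show ?thesis unfolding flip_def
    by (rule exI[of _ "x @ s"], rule exI[of _ a], rule exI[of _ d], rule exI[of _ "t @ y"])
      (use * in auto)
qed

lemma baxter_context: "v \<equiv>\<^sub>B w \<Longrightarrow> x @ v @ y \<equiv>\<^sub>B x @ w @ y"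
  by (intro baxter_append baxter_refl)

text \<open>The order of the separators decides which relation applies: the first if
  \<open>b < c\<close>, otherwise the second with \<open>b\<close> and \<open>c\<close>
  interchanged.\<close>

lemma flip_baxter:
  assumes "flip v w"
  shows "v \<equiv>\<^sub>B w"
proof -
  obtain s a d t c b where *: "v = s @ [a, d] @ t" "w = s @ [d, a] @ t"
    "c \<in> set s" "a < c" "c \<le> d" "b \<in> set t" "a \<le> b" "b < d"
    using assms unfolding flip_def by auto
  obtain s1 s2 where s: "s = s1 @ c # s2" using *(3) by (auto dest: split_list)
  obtain t1 t2 where t: "t = t1 @ b # t2" using *(6) by (auto dest: split_list)
  have "[c] @ s2 @ [a, d] @ t1 @ [b] \<equiv>\<^sub>B [c] @ s2 @ [d, a] @ t1 @ [b]"
  proof (cases "b < c")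
    case True
    then show ?thesis using * by (intro baxter_gen1)
  next
    case False
    then show ?thesis using * by (intro baxter_sym[OF baxter_gen2]) auto
  qed
  from baxter_context[OF this, of s1 t2] show ?thesis
    by (simp add: * s t)
qed

text \<open>The surrounding words \<open>x\<close> and \<open>y\<close> strengthen the induction: in
  the concatenation rule each factor is replaced while the other one serves as context.\<close>

lemma baxter_P_symbol_context: "v \<equiv>\<^sub>B w \<Longrightarrow> P_symbol (x @ v @ y) = P_symbol (x @ w @ y)"
proof (induction v w arbitrary: x y rule: baxter.induct)
  case (baxter_append u u' v v')
  have "P_symbol (x @ (u @ v) @ y) = P_symbol (x @ u' @ v @ y)"
    using baxter_append.IH(1)[of x "v @ y"] by simp
  also have "\<dots> = P_symbol (x @ (u' @ v') @ y)"
    using baxter_append.IH(2)[of "x @ u'" y] by simp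
  finally show ?case .
next
  case (baxter_gen1 a b c d u v)
  have "flip ([c] @ u @ [a, d] @ v @ [b]) ([c] @ u @ [d, a] @ v @ [b])"
    unfolding flip_def
    by (rule exI[of _ "[c] @ u"], rule exI[of _ a], rule exI[of _ d], rule exI[of _ "v @ [b]"])
      (use baxter_gen1 in auto)
  then show ?case by (intro flip_P_symbol flip_context)
next
  case (baxter_gen2 a b c d u v)
  have "flip ([b] @ u @ [a, d] @ v @ [c]) ([b] @ u @ [d, a] @ v @ [c])"
    unfolding flip_def
    by (rule exI[of _ "[b] @ u"], rule exI[of _ a], rule exI[of _ d], rule exI[of _ "v @ [c]"])
      (use baxter_gen2 in auto)
  then show ?case by (intro flip_P_symbol[symmetric] flip_context)
qed auto

lemma baxter_P_symbol: "v \<equiv>\<^sub>B w \<Longrightarrow> P_symbol v = P_symbol w"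
  using baxter_P_symbol_context[of v w "[]" "[]"] by simp

section \<open>Comparison of two words with the same P-symbol\<close>

lemma P_symbol_mset: "P_symbol v = P_symbol w \<Longrightarrow> mset v = mset w"
  by (metis P_symbol_eq_iff mset_left_tree surj_pair)

text \<open>If no letter of \<open>p\<close> separated \<open>y\<close> and \<open>z\<close>, they
  would reach the same free place, where \<open>y\<close> must be the root by the first word but
  comes too late in the second. Formally, the first letter \<open>q\<close> of \<open>p\<close>
  either separates them or sends both to one side, where the filtered words have a shorter prefix.
  For empty \<open>p\<close> the two roots differ, since \<open>y\<close> is not in
  \<open>w1\<close>.\<close>

lemma left_tree_separator:
  assumes "left_tree (p @ y # u) = left_tree (p @ w1 @ y # w2)" "y \<notin> set w1" "z \<in> set w1"
  shows "\<exists>c\<in>set p. min y z < c \<and> c \<le> max y z"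
  using assms
proof (induction "length p" arbitrary: p u w1 w2 rule: less_induct)
  case less
  show ?case
  proof (cases p)
    case Nil
    then show ?thesis using less.prems by (cases w1) (auto simp: left_tree_Cons)
  next
    case (Cons q p')
    note eq = less.prems(1)[unfolded Cons append_Cons left_tree_Cons tree.inject]
    have len: "length (filter P p') < length p" for P
      using length_filter_le[of P p'] by (simp add: Cons less_Suc_eq_le)
    consider "y < q" "z < q" | "q \<le> y" "q \<le> z" | "min y z < q" "q \<le> max y z"
      unfolding min_less_iff_disj le_max_iff_disj by (meson not_le)
    then show ?thesis
    proof cases
      case 1
      then show ?thesis
        using less.hyps[OF len[of "\<lambda>x. x < q"],
            of "filter (\<lambda>x. x < q) u" "filter (\<lambda>x. x < q) w1" "filter (\<lambda>x. x < q) w2"]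
          eq less.prems Cons by auto
    next
      case 2
      then show ?thesis
        using less.hyps[OF len[of "\<lambda>x. q \<le> x"],
            of "filter (\<lambda>x. q \<le> x) u" "filter (\<lambda>x. q \<le> x) w1" "filter (\<lambda>x. q \<le> x) w2"]
          eq less.prems Cons by auto
    next
      case 3
      then show ?thesis using Cons by auto
    qed
  qed
qed

text \<open>The counterpart read from the right end, by induction on \<open>w2\<close>: the last
  letters of both words are the common root \<open>q\<close>, which either separates
  \<open>y\<close> and \<open>z\<close> or sends both to one side. If \<open>w2\<close> is empty,
  then \<open>q = y\<close> is a letter of \<open>u\<close>, hence of \<open>w1\<close>, which is
  excluded.\<close>

lemma right_tree_separator:
  assumes "right_tree (p @ y # u) = right_tree (p @ w1 @ y # w2)" "y \<notin> set w1" "z \<in> set w1"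
  shows "\<exists>b\<in>set w2. min y z \<le> b \<and> b < max y z"
  using assms
proof (induction "length w2" arbitrary: p u w1 w2 rule: less_induct)
  case less
  have "mset (p @ y # u) = mset (p @ w1 @ y # w2)"
    using less.prems(1) by (metis mset_right_tree)
  then have ms: "mset u = mset w1 + mset w2" by simp
  then have "u \<noteq> []" using less.prems(3) by auto
  then obtain u' q where u: "u = u' @ [q]" by (metis rev_exhaust)
  have uq: "p @ y # u = (p @ y # u') @ [q]" using u by simp
  show ?case
  proof (cases w2 rule: rev_cases)
    case Nil
    have "right_tree ((p @ y # u') @ [q]) = right_tree ((p @ w1) @ [y])"
      using less.prems(1) uq Nil by simp
    then have "q = y" by (simp only: right_tree_snoc tree.inject)
    moreover have "q \<in> set w1" using ms u Nil
      by (metis add.right_neutral mset.simps(1) set_mset_mset in_set_conv_decomp)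
    ultimately show ?thesis using less.prems(2) by simp
  next
    case (snoc w2' q')
    have "right_tree ((p @ y # u') @ [q]) = right_tree ((p @ w1 @ y # w2') @ [q'])"
      using less.prems(1) uq snoc by simp
    note eq = this[unfolded right_tree_snoc tree.inject]
    have len: "length (filter P w2') < length w2" for P
      using length_filter_le[of P w2'] by (simp add: snoc less_Suc_eq_le)
    consider "y \<le> q" "z \<le> q" | "q < y" "q < z" | "min y z \<le> q" "q < max y z"
      unfolding min_le_iff_disj less_max_iff_disj by (meson not_le)
    then show ?thesis
    proof cases
      case 1
      then show ?thesis
        using less.hyps[OF len[of "\<lambda>x. x \<le> q"], of "filter (\<lambda>x. x \<le> q) p"
            "filter (\<lambda>x. x \<le> q) u'" "filter (\<lambda>x. x \<le> q) w1"]
          eq less.prems snoc by auto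
    next
      case 2
      then show ?thesis
        using less.hyps[OF len[of "\<lambda>x. q < x"], of "filter (\<lambda>x. q < x) p"
            "filter (\<lambda>x. q < x) u'" "filter (\<lambda>x. q < x) w1"]
          eq less.prems snoc by auto
    next
      case 3
      then show ?thesis using eq snoc by auto
    qed
  qed
qed

lemma lexordp_same_mset:
  fixes v w :: "'a::linorder list"
  assumes "ord_class.lexordp w v" "mset v = mset w"
  obtains p y x w' v' where "w = p @ y # w'" "v = p @ x # v'" "y < x"
proof -
  have len: "length v = length w" using assms(2) by (metis size_mset)
  from assms(1) consider x vs where "v = w @ x # vs"
    | us a b vs ws where "a < b" "w = us @ a # vs" "v = us @ b # ws"
    unfolding lexordp_iff by blast
  then show ?thesis
  proof cases
    case 2
    then show ?thesis using that[of us a vs b ws] by simp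
  qed (use len in simp)
qed

lemma first_occurrence_after_prefix:
  assumes "mset (p @ y # w') = mset (p @ x # v')" "x \<noteq> y"
  obtains w1 w2 where "p @ x # v' = p @ w1 @ y # w2" "y \<notin> set w1" "x \<in> set w1"
proof -
  have "y \<in> set v'" using assms
    by (metis add_left_imp_eq insertE list.set_intros(1) list.simps(15) mset_append set_mset_mset)
  then obtain a b where "v' = a @ y # b" "y \<notin> set a"
    by (meson split_list_first)
  then show ?thesis using that[of "x # a" b] assms(2) by auto
qed

text \<open>Going from \<open>v\<close> to \<open>w\<close>, the letter \<open>y\<close> has to move to the left across \<open>w1\<close>. In \<open>w1\<close>, the last
  letter greater than \<open>y\<close> can be exchanged with its right neighbour.\<close>

lemma flip_downwards:
  assumes P: "P_symbol v = P_symbol w" and "ord_class.lexordp w v"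
  shows "\<exists>v'. flip v' v"
proof -
  note ms = P_symbol_mset[OF P]
  obtain p y x w' v' where w: "w = p @ y # w'" and v: "v = p @ x # v'" and "y < x"
    using lexordp_same_mset[OF assms(2) ms] .
  obtain w1 w2 where v2: "v = p @ w1 @ y # w2" and y: "y \<notin> set w1" and x: "x \<in> set w1"
    using first_occurrence_after_prefix[of p y w' x v'] ms w v \<open>y < x\<close> by (metis less_irrefl)
  obtain ys z zs where w1: "w1 = ys @ z # zs" and z: "y < z" and zs: "\<forall>z\<in>set zs. \<not> y < z"
    using split_list_last_prop[of w1 "\<lambda>z. y < z"] x \<open>y < x\<close> by blast
  have L: "left_tree (p @ y # w') = left_tree (p @ w1 @ y # w2)"
    and R: "right_tree (p @ y # w') = right_tree (p @ w1 @ y # w2)"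
    using P v2 w P_symbol_eq_iff by (metis surj_pair)+
  obtain c where c: "c \<in> set p" "y < c" "c \<le> z"
    using left_tree_separator[OF L y, of z] z w1 by (auto simp: min_def max_def split: if_splits)
  obtain b where b: "b \<in> set w2" "y \<le> b" "b < z"
    using right_tree_separator[OF R y, of z] z w1 by (auto simp: min_def max_def split: if_splits)
  show ?thesis
  proof (cases zs)
    case Nil
    have "flip ((p @ ys) @ [y, z] @ w2) ((p @ ys) @ [z, y] @ w2)"
      unfolding flip_def using b c by (metis Un_iff set_append)
    then show ?thesis using v2 w1 Nil by auto
  next
    case (Cons z1 zs')
    then have "z1 \<le> y" using zs by auto
    then have "z1 < c" "z1 \<le> y" "y < z" using z c by auto
    then have "flip ((p @ ys) @ [z1, z] @ zs' @ y # w2) ((p @ ys) @ [z, z1] @ zs' @ y # w2)"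
      unfolding flip_def using c by (metis Un_iff set_append list.set_intros(1))
    then show ?thesis using v2 w1 Cons by auto
  qed
qed

text \<open>Again \<open>y\<close> has to move to the left across \<open>w1\<close>, but now the
  last letter \<open>z\<close> of \<open>w1\<close> smaller than \<open>y\<close> is exchanged with
  its right neighbour. If this neighbour \<open>z1\<close> is not \<open>y\<close>, it exceeds
  \<open>y\<close>; then \<open>c\<close> still separates before the pair, and \<open>y\<close>
  itself separates after it.\<close>

lemma flip_upwards:
  assumes P: "P_symbol v = P_symbol w" and "ord_class.lexordp v w"
  shows "\<exists>v'. flip v v'"
proof -
  note ms = P_symbol_mset[OF P]
  obtain p y x w' v' where w: "w = p @ y # w'" and v: "v = p @ x # v'" and "x < y"
    using lexordp_same_mset[OF assms(2) ms[symmetric]] by metis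
  obtain w1 w2 where v2: "v = p @ w1 @ y # w2" and y: "y \<notin> set w1" and x: "x \<in> set w1"
    using first_occurrence_after_prefix[of p y w' x v'] ms w v \<open>x < y\<close> by (metis less_irrefl)
  obtain ys z zs where w1: "w1 = ys @ z # zs" and z: "z < y" and zs: "\<forall>z\<in>set zs. \<not> z < y"
    using split_list_last_prop[of w1 "\<lambda>z. z < y"] x \<open>x < y\<close> by blast
  have L: "left_tree (p @ y # w') = left_tree (p @ w1 @ y # w2)"
    and R: "right_tree (p @ y # w') = right_tree (p @ w1 @ y # w2)"
    using P v2 w P_symbol_eq_iff by (metis surj_pair)+
  obtain c where c: "c \<in> set p" "z < c" "c \<le> y"
    using left_tree_separator[OF L y, of z] z w1 by (auto simp: min_def max_def split: if_splits)
  obtain b where b: "b \<in> set w2" "z \<le> b" "b < y"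
    using right_tree_separator[OF R y, of z] z w1 by (auto simp: min_def max_def split: if_splits)
  show ?thesis
  proof (cases zs)
    case Nil
    have "flip ((p @ ys) @ [z, y] @ w2) ((p @ ys) @ [y, z] @ w2)"
      unfolding flip_def using b c by (metis Un_iff set_append)
    then show ?thesis using v2 w1 Nil by auto
  next
    case (Cons z1 zs')
    then have "y < z1" using zs y w1 by (cases y z1 rule: linorder_cases) auto
    then have "c \<le> z1" "z \<le> y" "y < z1" using z c by auto
    then have "flip ((p @ ys) @ [z, z1] @ zs' @ y # w2) ((p @ ys) @ [z1, z] @ zs' @ y # w2)"
      unfolding flip_def using c by (metis Un_iff set_append list.set_intros(1))
    then show ?thesis using v2 w1 Cons by auto
  qed
qed

section \<open>Flips joining a class to its lexicographic extremes\<close>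

lemma flip_lexordp: "flip v w \<Longrightarrow> ord_class.lexordp v w"
  unfolding flip_def by (auto intro!: lexordp_append_left_rightI)

lemma finite_P_symbol_class: "finite {v. P_symbol v = X}"
proof (cases "\<exists>w. P_symbol w = X")
  case True
  then obtain w where "P_symbol w = X" by blast
  have "set v \<subseteq> set w \<and> length v = length w" if "P_symbol v = X" for v
    using P_symbol_mset[of v w] that \<open>P_symbol w = X\<close> mset_eq_setD mset_eq_length by fastforce
  then have "{v. P_symbol v = X} \<subseteq> {v. set v \<subseteq> set w \<and> length v = length w}" by blast
  then show ?thesis by (rule finite_subset) (simp add: finite_lists_length_eq)
qed simp

text \<open>Any word of the fibre other than \<open>w\<close> is the target of a flip from a
  lexicographically smaller word of the fibre. The fibre is finite, so the number of its words below
  \<open>v\<close> drops until \<open>w\<close> is reached.\<close>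

lemma flips_from_lex_min:
  assumes P: "P_symbol v = P_symbol w" and least: "\<And>x. P_symbol x = P_symbol w \<Longrightarrow> lexordp_eq w x"
  shows "flip\<^sup>*\<^sup>* w v"
  using P
proof (induction "card {x. P_symbol x = P_symbol w \<and> ord_class.lexordp x v}" arbitrary: v rule: less_induct)
  case less
  show ?case
  proof (cases "v = w")
    case False
    then have "ord_class.lexordp w v" using least[OF less.prems] by (simp add: lexordp_eq_conv_lexord)
    then obtain v' where f: "flip v' v" using flip_downwards[OF less.prems] by blast
    have P': "P_symbol v' = P_symbol w" using flip_P_symbol[OF f] less.prems by simp
    have "{x. P_symbol x = P_symbol w \<and> ord_class.lexordp x v'} \<subset>
        {x. P_symbol x = P_symbol w \<and> ord_class.lexordp x v}" (is "?A \<subset> ?B")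
    proof (rule psubsetI)
      show "?A \<subseteq> ?B" using lexordp_trans[OF _ flip_lexordp[OF f]] by blast
      have "v' \<in> ?B" "v' \<notin> ?A" using P' flip_lexordp[OF f] lexordp_irreflexive' by auto
      then show "?A \<noteq> ?B" by metis
    qed
    moreover have "finite ?B" by (rule finite_subset[OF _ finite_P_symbol_class]) blast
    ultimately have "flip\<^sup>*\<^sup>* w v'" using less.hyps[OF psubset_card_mono P'] by blast
    then show ?thesis using f by simp
  qed simp
qed

lemma flips_to_lex_max:
  assumes P: "P_symbol v = P_symbol w" and greatest: "\<And>x. P_symbol x = P_symbol w \<Longrightarrow> lexordp_eq x w"
  shows "flip\<^sup>*\<^sup>* v w"
  using P
proof (induction "card {x. P_symbol x = P_symbol w \<and> ord_class.lexordp v x}" arbitrary: v rule: less_induct)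
  case less
  show ?case
  proof (cases "v = w")
    case False
    then have "ord_class.lexordp v w" using greatest[OF less.prems] by (simp add: lexordp_eq_conv_lexord)
    then obtain v' where f: "flip v v'" using flip_upwards[OF less.prems] by blast
    have P': "P_symbol v' = P_symbol w" using flip_P_symbol[OF f] less.prems by simp
    have "{x. P_symbol x = P_symbol w \<and> ord_class.lexordp v' x} \<subset>
        {x. P_symbol x = P_symbol w \<and> ord_class.lexordp v x}" (is "?A \<subset> ?B")
    proof (rule psubsetI)
      show "?A \<subseteq> ?B" using lexordp_trans[OF flip_lexordp[OF f]] by blast
      have "v' \<in> ?B" "v' \<notin> ?A" using P' flip_lexordp[OF f] lexordp_irreflexive' by auto
      then show "?A \<noteq> ?B" by metis
    qed
    moreover have "finite ?B" by (rule finite_subset[OF _ finite_P_symbol_class]) blast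
    ultimately have "flip\<^sup>*\<^sup>* v' w" using less.hyps[OF psubset_card_mono P'] by blast
    then show ?thesis using f by (simp add: converse_rtranclp_into_rtranclp)
  qed simp
qed

lemma flips_baxter: "flip\<^sup>*\<^sup>* v w \<Longrightarrow> v \<equiv>\<^sub>B w"
proof (induction rule: rtranclp_induct)
  case (step x y)
  then show ?case using baxter_trans flip_baxter by blast
qed (rule baxter_refl)

text \<open>The flips leading down to the lexicographically least word connect the whole class.\<close>

lemma encoded_class_eq:
  assumes P: "P_symbol w = (TL, TR)" and least: "\<And>x. P_symbol x = (TL, TR) \<Longrightarrow> lexordp_eq w x"
  shows "encoded_class TL TR = {v. P_symbol v = (TL, TR)}"
proof -
  have "w \<equiv>\<^sub>B v" if "P_symbol v = (TL, TR)" for v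
    using flips_baxter[OF flips_from_lex_min[of v w]] that P least by simp
  then have "{v. u \<equiv>\<^sub>B v} = {v. P_symbol v = (TL, TR)}" if "P_symbol u = (TL, TR)" for u
    using that by (metis baxter_P_symbol baxter_sym baxter_trans)
  then show ?thesis unfolding encoded_class_def using P by (intro the_equality) auto
qed

section \<open>Flips as covers of the permutohedron\<close>

lemma flip_permutohedron_covered:
  assumes "flip v w" "is_permutation A n v"
  shows "permutohedron_covered A n v w"
proof -
  obtain s a d t where *: "v = s @ [a, d] @ t" "w = s @ [d, a] @ t" "a < d"
    using assms(1) unfolding flip_def by (auto dest: less_le_trans)
  moreover have "is_permutation A n w" using assms(2) * by (auto simp: is_permutation_def)
  ultimately show ?thesis using assms(2) unfolding permutohedron_covered_def by blast
qed

lemma flips_permutohedron_le: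
  assumes "flip\<^sup>*\<^sup>* v w" "is_permutation A n v"
  shows "permutohedron_le A n v w"
proof -
  have "permutohedron_le A n v w \<and> is_permutation A n w" using assms
  proof (induction rule: rtranclp_induct)
    case (step x y)
    then have "permutohedron_covered A n x y" by (simp add: flip_permutohedron_covered)
    moreover have "is_permutation A n y"
      using calculation by (simp add: permutohedron_covered_def)
    ultimately show ?case using step unfolding permutohedron_le_def
      by (auto intro: rtranclp.rtrancl_into_rtrancl)
  qed (simp add: permutohedron_le_def)
  then show ?thesis ..
qed

section \<open>Gaps between consecutive nodes\<close>

text \<open>A gap between two trees of the forest puts no condition on the other tree: it is written
  \<open>2\<close>, which differs from both sides. \<open>gaps F\<close> also has an entry \<open>2\<close> at either end, to match
  \<open>leaf_sides\<close> rather than \<open>canopy\<close>.\<close>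

definition gaps :: "'a tree list \<Rightarrow> nat list" where
  "gaps F = concat (map (\<lambda>t. 2 # canopy t) F) @ [2]"

lemma gaps_Nil [simp]: "gaps [] = [2]"
  and gaps_Cons: "gaps (t # F) = 2 # canopy t @ gaps F"
  and gaps_append: "gaps (F @ G) = concat (map (\<lambda>t. 2 # canopy t) F) @ gaps G"
  by (simp_all add: gaps_def)

section \<open>Leaf sides, canopies and gaps of a forest\<close>

lemma length_leaf_sides [simp]: "length (leaf_sides d t) = Suc (size t)"
  by (induction t arbitrary: d) auto

lemma length_canopy [simp]: "length (canopy t) = size t - 1"
  by (simp add: canopy_def)

text \<open>The outermost leaves of a nonempty tree are a left child and a right child, so the value
  \<open>d\<close> only shows up for the empty tree.\<close>

lemma leaf_sides_canopy:
  assumes "t \<noteq> Leaf"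
  shows "leaf_sides d t = 1 # canopy t @ [0]"
proof -
  have first: "\<exists>m. leaf_sides 1 s = 1 # m" for s :: "'a tree"
    by (induction s) auto
  have last: "\<exists>m. leaf_sides 0 s = m @ [0]" for s :: "'a tree"
    by (induction s) auto
  obtain l x r where t: "t = Node l x r" using assms by (cases t) auto
  obtain m m' where "leaf_sides 1 l = 1 # m" "leaf_sides 0 r = m' @ [0]"
    using first[of l] last[of r] by blast
  then show ?thesis by (simp add: t canopy_def butlast_append)
qed

text \<open>The last leaf of a nonempty \<open>l\<close> and the first leaf of a nonempty
  \<open>r\<close> become interior leaves. If \<open>l\<close> or \<open>r\<close> is empty, its
  single leaf is an outermost one and is dropped.\<close>

lemma canopy_Node:
  "canopy (Node l x r) =
     (if l = Leaf then [] else canopy l @ [0]) @ (if r = Leaf then [] else 1 # canopy r)"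
proof -
  have "canopy (Node l x r) = butlast (tl (leaf_sides 1 l @ leaf_sides 0 r))"
    by (simp add: canopy_def)
  then show ?thesis
    by (cases "l = Leaf"; cases "r = Leaf")
      (simp_all add: leaf_sides_canopy butlast_append)
qed

text \<open>The free gap before a tree makes up for its canopy being one shorter than its size.
  Hence entry \<open>k\<close> of \<open>gaps\<close>, counted from \<open>0\<close>, is the gap
  just before node \<open>k\<close>.\<close>

lemma length_gaps_prefix:
  "Leaf \<notin> set F \<Longrightarrow> length (concat (map (\<lambda>t. 2 # canopy t) F)) = length (concat (map inorder F))"
proof (induction F)
  case (Cons t F)
  then obtain l x r where "t = Node l x r" by (cases t) auto
  then show ?case using Cons by simp
qed simp

text \<open>Suppressing a root merges the gaps \<open>x\<close> and \<open>y\<close> on its two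
  sides into one free gap and leaves all others alone. The gap \<open>x\<close> is \<open>0\<close>,
  or already free when \<open>l\<close> is empty; \<open>y\<close> is \<open>1\<close>, or already
  free when \<open>r\<close> is empty.\<close>

lemma gaps_forest_split:
  assumes "Leaf \<notin> set F1"
  shows "\<exists>gs x y hs. gaps (F1 @ Node l i r # F2) = gs @ x # y # hs \<and>
    gaps (F1 @ forest [l, r] @ F2) = gs @ 2 # hs \<and>
    length gs = length (concat (map inorder F1) @ inorder l)"
proof -
  let ?p = "concat (map (\<lambda>t. 2 # canopy t) F1)"
  obtain h where h: "gaps F2 = 2 # h" by (cases F2) (auto simp: gaps_Cons)
  have len: "length ?p = length (concat (map inorder F1))"
    using length_gaps_prefix[OF assms] .
  have sl: "l \<noteq> Leaf \<Longrightarrow> Suc (size l - 1) = size l" by (cases l) auto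
  let ?gs = "?p @ (if l = Leaf then [] else 2 # canopy l)"
  let ?x = "if l = Leaf then 2 else 0"
  let ?y = "if r = Leaf then 2 else 1"
  let ?hs = "if r = Leaf then h else canopy r @ gaps F2"
  have "gaps (F1 @ Node l i r # F2) = ?gs @ ?x # ?y # ?hs"
    by (simp add: gaps_append gaps_Cons canopy_Node h)
  moreover have "gaps (F1 @ forest [l, r] @ F2) = ?gs @ 2 # ?hs"
    by (simp add: gaps_append gaps_Cons forest_def h)
  moreover have "length ?gs = length (concat (map inorder F1) @ inorder l)"
    using len sl by auto
  ultimately show ?thesis by blast
qed

text \<open>Leaves \<open>k\<close> and \<open>Suc k\<close> are the neighbours of node
  \<open>k\<close> in the inorder traversal. A nonempty left subtree would end in a right child, a
  nonempty right subtree would begin with a left child.\<close>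

lemma childless_if_valley:
  assumes "leaf_sides e T ! k = 1" "leaf_sides e T ! Suc k = 0" "k < size T"
  shows "Node Leaf (inorder T ! k) Leaf \<in> subtrees T"
  using assms
proof (induction T arbitrary: e k)
  case (Node l j r)
  consider "k < size l" | "k = size l" | k' where "k = Suc (size l + k')"
    by (metis add_Suc less_imp_Suc_add linorder_neqE_nat)
  then show ?case
  proof cases
    case 1
    then have "Node Leaf (inorder l ! k) Leaf \<in> subtrees l"
      using Node.prems by (intro Node.IH(1)[of 1]) (auto simp: nth_append)
    then show ?thesis using 1 by (simp add: nth_append)
  next
    case 2
    have "leaf_sides 1 l ! size l = 1" "leaf_sides 0 r ! 0 = 0"
      using Node.prems 2 by (auto simp: nth_append)
    then have "l = Leaf" "r = Leaf"
      using leaf_sides_canopy[of l 1] leaf_sides_canopy[of r 0]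
      by (cases l; cases r; auto simp: nth_append)+
    then show ?thesis using 2 by simp
  next
    case 3
    then have "Node Leaf (inorder r ! k') Leaf \<in> subtrees r"
      using Node.prems by (intro Node.IH(2)[of 0]) (auto simp: nth_append)
    then show ?thesis using 3 by (simp add: nth_append)
  qed
qed simp

section \<open>Suppression of a childless node\<close>

lemma suppress_childless_id [simp]: "i \<notin> set_tree T \<Longrightarrow> suppress_childless i T = T"
  by (induction T) auto

lemma set_tree_suppress_childless: "set_tree (suppress_childless i T) \<subseteq> set_tree T"
  by (induction T) auto

lemma right_bst_suppress_childless:
  "right_bst (map_tree f T) \<Longrightarrow> right_bst (map_tree f (suppress_childless i T))"
proof (induction T)
  case (Node l j r)
  then show ?case
    using set_tree_suppress_childless[of i l] set_tree_suppress_childless[of i r]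
    by (auto simp: tree.set_map)
qed simp

text \<open>The two leaves below node \<open>i\<close> are replaced by one, whose side
  \<open>d\<close> depends on where \<open>i\<close> hangs. Only \<open>d \<noteq> 2\<close> is
  recorded: this makes it compatible with the free gap that arises in the forest. If
  \<open>i\<close> is the whole tree, then \<open>d = e\<close>.\<close>

lemma suppress_childless_split:
  assumes "distinct (inorder T)" "Node Leaf i Leaf \<in> subtrees T" "e \<noteq> 2"
  shows "\<exists>xs ys ss ts d. inorder T = xs @ i # ys \<and> inorder (suppress_childless i T) = xs @ ys \<and>
    leaf_sides e T = ss @ [1, 0] @ ts \<and> leaf_sides e (suppress_childless i T) = ss @ d # ts \<and>
    length ss = length xs \<and> d \<noteq> 2"
  using assms
proof (induction T arbitrary: e)
  case (Node l j r)
  consider "l = Leaf" "r = Leaf" "j = i"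
    | "Node Leaf i Leaf \<in> subtrees l" | "Node Leaf i Leaf \<in> subtrees r"
    using Node.prems(2) by auto
  then show ?case
  proof cases
    case 1
    then show ?thesis using Node.prems(3)
      by (intro exI[of _ "[]"] exI[of _ e]) simp
  next
    case 2
    then obtain xs ys ss ts d where *: "inorder l = xs @ i # ys"
      "inorder (suppress_childless i l) = xs @ ys" "leaf_sides 1 l = ss @ [1, 0] @ ts"
      "leaf_sides 1 (suppress_childless i l) = ss @ d # ts" "length ss = length xs" "d \<noteq> 2"
      using Node.IH(1)[of 1] Node.prems by auto
    have "i \<in> set_tree l" using 2 in_set_tree_if by fastforce
    then have "i \<notin> set_tree r" "j \<noteq> i" using Node.prems(1) by auto
    then show ?thesis using *
      by (intro exI[of _ xs] exI[of _ "ys @ j # inorder r"] exI[of _ ss]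
            exI[of _ "ts @ leaf_sides 0 r"] exI[of _ d]) simp
  next
    case 3
    then obtain xs ys ss ts d where *: "inorder r = xs @ i # ys"
      "inorder (suppress_childless i r) = xs @ ys" "leaf_sides 0 r = ss @ [1, 0] @ ts"
      "leaf_sides 0 (suppress_childless i r) = ss @ d # ts" "length ss = length xs" "d \<noteq> 2"
      using Node.IH(2)[of 0] Node.prems by auto
    have "i \<in> set_tree r" using 3 in_set_tree_if by fastforce
    then have "i \<notin> set_tree l" "j \<noteq> i" using Node.prems(1) by auto
    then show ?thesis using *
      by (intro exI[of _ "inorder l @ j # xs"] exI[of _ ys] exI[of _ "leaf_sides 1 l @ ss"]
            exI[of _ ts] exI[of _ d]) simp
  qed
qed simp

text \<open>At the root of a tree of the forest, the left gap is \<open>0\<close> or a free one and the right gap is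
  \<open>1\<close> or a free one. As \<open>S\<close> goes from \<open>1\<close> to \<open>0\<close>, it has to descend between the free gaps
  around one of the trees, and then the root of this tree qualifies.\<close>

lemma exists_root_in_valley:
  assumes "list_all2 (\<noteq>) (gaps F) S" "hd S = 1" "last S = 0" "set S \<subseteq> {0, 1}"
    and "F \<noteq> []" "Leaf \<notin> set F"
  shows "\<exists>F1 l i r F2 ss ts. F = F1 @ Node l i r # F2 \<and> S = ss @ [1, 0] @ ts \<and>
    length ss = length (concat (map inorder F1) @ inorder l)"
  using assms
proof (induction F arbitrary: S)
  case (Cons t F)
  obtain S1 S2 where S: "S = 1 # S1 @ S2" and S1: "list_all2 (\<noteq>) (canopy t) S1"
    and S2: "list_all2 (\<noteq>) (gaps F) S2"
    using Cons.prems(1,2) by (auto simp: gaps_Cons list_all2_Cons1 list_all2_append1)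
  have S2_ne: "S2 \<noteq> []" using S2 by (cases F) (auto simp: gaps_Cons)
  have len: "length (1 # S1) = size t"
    using list_all2_lengthD[OF S1] Cons.prems(6) by (cases t) auto
  \<comment> \<open>\<open>hd S2\<close> faces the free gap behind \<open>t\<close>. If it is
    \<open>1\<close>, the remaining trees satisfy the same boundary conditions; if it is
    \<open>0\<close>, then \<open>S\<close> descends across \<open>t\<close> itself.\<close>
  consider "hd S2 = 1" | "hd S2 = 0" using Cons.prems(4) S S2_ne by (cases S2) auto
  then show ?case
  proof cases
    case 1
    have "F \<noteq> []"
    proof
      assume "F = []"
      then have "length S2 = 1" using S2 by (auto dest: list_all2_lengthD)
      then have "hd S2 = last S2" by (cases S2) auto
      then show False using 1 Cons.prems(3) S S2_ne by simp
    qed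
    moreover have "last S2 = 0" "set S2 \<subseteq> {0, 1}" "Leaf \<notin> set F"
      using Cons.prems(3,4,6) S S2_ne by auto
    ultimately obtain F1 l i r F2 ss ts where *: "F = F1 @ Node l i r # F2" "S2 = ss @ [1, 0] @ ts"
      "length ss = length (concat (map inorder F1) @ inorder l)"
      using Cons.IH[OF S2 1] by metis
    then show ?thesis using S len
      by (intro exI[of _ "t # F1"] exI[of _ l] exI[of _ i] exI[of _ r] exI[of _ F2]
            exI[of _ "1 # S1 @ ss"] exI[of _ ts]) simp
  next
    case 2
    obtain l i r where t: "t = Node l i r" using Cons.prems(6) by (cases t) auto
    obtain A B where AB: "S1 = A @ B"
      "list_all2 (\<noteq>) (if l = Leaf then [] else canopy l @ [0]) A"
      "list_all2 (\<noteq>) (if r = Leaf then [] else 1 # canopy r) B"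
      using S1 unfolding t canopy_Node by (auto simp: list_all2_append1)
    have set: "set A \<subseteq> {0, 1}" "set B \<subseteq> {0, 1}" using Cons.prems(4) S AB(1) by auto
    \<comment> \<open>The entry of \<open>S\<close> just before the root is \<open>1\<close>: it is
      opposite the closing \<open>0\<close> of the left part, or it is the initial \<open>1\<close>
      if \<open>l\<close> is empty. Likewise the entry just after the root is \<open>0\<close>,
      being opposite a \<open>1\<close> or equal to \<open>hd S2\<close>.\<close>
    have "\<exists>ss. 1 # A = ss @ [1] \<and> length ss = size l"
    proof (cases "l = Leaf")
      case False
      then obtain A' where "A = A' @ [1]" "length A' = size l - 1"
        using AB(2) set(1) by (auto simp: list_all2_append1 list_all2_Cons1 dest: list_all2_lengthD)
      then show ?thesis using False by (intro exI[of _ "1 # A'"]) (cases l; simp)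
    qed (use AB in simp)
    then obtain ss where ss: "1 # A = ss @ [1]" "length ss = size l" by blast
    have "\<exists>ts. B @ S2 = 0 # ts"
      using AB(3) set(2) 2 S2_ne by (cases "r = Leaf"; cases S2) (auto simp: list_all2_Cons1)
    then obtain ts where "B @ S2 = 0 # ts" by blast
    then have "S = ss @ [1, 0] @ ts" using S AB(1) ss(1)
      by (metis append.assoc append_Cons append_Nil)
    then show ?thesis using t ss(2)
      by (intro exI[of _ "[]"] exI[of _ l] exI[of _ i] exI[of _ r] exI[of _ F]
            exI[of _ ss] exI[of _ ts]) simp
  qed
qed simp

section \<open>The states of the algorithms\<close>

text \<open>The invariant of the loop, with \<open>f\<close> giving the label of an index. The
  condition on \<open>gaps\<close> is what survives of the twin condition. By the last clause
  different trees of the forest share no label, although a label may be repeated inside a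
  tree.\<close>

definition extract_state :: "(nat \<Rightarrow> 'a::linorder) \<Rightarrow> nat tree list \<Rightarrow> nat tree \<Rightarrow> bool" where
  "extract_state f F T \<longleftrightarrow>
     Leaf \<notin> set F \<and> concat (map inorder F) = inorder T \<and> sorted_wrt (<) (inorder T) \<and>
     list_all2 (\<noteq>) (gaps F) (leaf_sides 0 T) \<and>
     mono_on (set_tree T) f \<and> right_bst (map_tree f T) \<and> (\<forall>t\<in>set F. left_bst (map_tree f t)) \<and>
     sorted_wrt (\<lambda>s t. \<forall>x\<in>set_tree s. \<forall>y\<in>set_tree t. f x < f y) F"

lemma suppress_root_split:
  assumes "Leaf \<notin> set (F1 @ F2)" "i \<notin> (\<Union>t\<in>set (F1 @ F2). set_tree t)"
  shows "suppress_root i (F1 @ Node l i r # F2) = F1 @ forest [l, r] @ F2"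
proof -
  have "suppress_if_root i t = [t]" if "t \<noteq> Leaf" "i \<notin> set_tree t" for t
    using that by (cases t) auto
  then have "Leaf \<notin> set F \<Longrightarrow> i \<notin> (\<Union>t\<in>set F. set_tree t) \<Longrightarrow>
      concat (map (suppress_if_root i) F) = F" for F
    by (induction F) auto
  then show ?thesis using assms by (simp add: suppress_root_def)
qed

lemma extract_state_set:
  "extract_state f F T \<Longrightarrow> set_tree T = (\<Union>t\<in>set F. set_tree t)"
proof -
  assume "extract_state f F T"
  then have "set (concat (map inorder F)) = set (inorder T)" by (simp add: extract_state_def)
  then show ?thesis by simp
qed

lemma extract_state_suppress_root:
  assumes "extract_state f (F1 @ Node l i r # F2) T"
  shows "suppress_root i (F1 @ Node l i r # F2) = F1 @ forest [l, r] @ F2"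
proof (rule suppress_root_split)
  have "distinct (concat (map inorder (F1 @ Node l i r # F2)))"
    using assms unfolding extract_state_def by (simp only: strict_sorted_iff)
  then show "i \<notin> (\<Union>t\<in>set (F1 @ F2). set_tree t)" by auto
  show "Leaf \<notin> set (F1 @ F2)" using assms by (simp add: extract_state_def)
qed

lemma candidatesE:
  assumes "i \<in> candidates F T"
  obtains F1 l r F2 where "F = F1 @ Node l i r # F2" "Node Leaf i Leaf \<in> subtrees T"
proof -
  obtain l r where "Node l i r \<in> set F" and "Node Leaf i Leaf \<in> subtrees T"
    using assms by (auto simp: candidates_def)
  then show ?thesis using that by (meson split_list)
qed

lemma candidates_nonempty:
  assumes st: "extract_state f F T" and "F \<noteq> []"
  shows "candidates F T \<noteq> {}"
proof -
  have "inorder T \<noteq> []" using assms unfolding extract_state_def by (cases F) (auto split: tree.splits)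
  then have "T \<noteq> Leaf" by auto
  note sides = leaf_sides_canopy[OF this, of 0]
  have "set (leaf_sides 0 T) \<subseteq> {0, 1}"
  proof -
    have "d \<in> {0, 1} \<Longrightarrow> set (leaf_sides d s) \<subseteq> {0, 1}" for d and s :: "nat tree"
      by (induction s arbitrary: d) auto
    then show ?thesis by simp
  qed
  moreover have "hd (leaf_sides 0 T) = 1" "last (leaf_sides 0 T) = 0" using sides by simp_all
  ultimately obtain F1 l i r F2 ss ts where *: "F = F1 @ Node l i r # F2"
    "leaf_sides 0 T = ss @ [1, 0] @ ts" "length ss = length (concat (map inorder F1) @ inorder l)"
    using exists_root_in_valley[of F "leaf_sides 0 T"] st assms(2)
    unfolding extract_state_def by metis
  \<comment> \<open>\<open>length ss\<close> is the position of \<open>i\<close> in the common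
    inorder reading, so the descent of the leaf sides is around this very node of
    \<open>T\<close>.\<close>
  have "inorder T = (concat (map inorder F1) @ inorder l) @ i # inorder r @ concat (map inorder F2)"
    using st *(1) by (simp add: extract_state_def)
  then have "inorder T ! length ss = i" "length ss < length (inorder T)"
    unfolding *(3) by (simp_all only: nth_append_length) simp
  moreover have "leaf_sides 0 T ! length ss = 1" "leaf_sides 0 T ! Suc (length ss) = 0"
    using *(2) by (simp_all add: nth_append)
  ultimately have "Node Leaf i Leaf \<in> subtrees T"
    using childless_if_valley[of 0 T "length ss"] by simp
  then show ?thesis using *(1) by (auto simp: candidates_def)
qed

text \<open>Both side sequences shrink at the same place, since \<open>i\<close> has the same
  position in the two inorder readings: the forest gets a free gap there and \<open>T\<close> a leaf
  of side \<open>d \<noteq> 2\<close>.\<close>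

lemma extract_state_step:
  assumes st: "extract_state f F T" and i: "i \<in> candidates F T"
  shows "extract_state f (suppress_root i F) (suppress_childless i T)"
    and "size (suppress_childless i T) < size T"
proof -
  obtain F1 l r F2 where F: "F = F1 @ Node l i r # F2" and leaf: "Node Leaf i Leaf \<in> subtrees T"
    using candidatesE[OF i] .
  let ?F = "F1 @ forest [l, r] @ F2" and ?T = "suppress_childless i T"
  have root: "suppress_root i F = ?F"
    using extract_state_suppress_root st F by blast
  have "distinct (inorder T)" using st by (simp add: extract_state_def strict_sorted_iff)
  then obtain xs ys ss ts d where *: "inorder T = xs @ i # ys" "inorder ?T = xs @ ys"
    "leaf_sides 0 T = ss @ [1, 0] @ ts" "leaf_sides 0 ?T = ss @ d # ts" "length ss = length xs" "d \<noteq> 2"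
    using suppress_childless_split[OF _ leaf, of 0] by auto
  then show "size ?T < size T" by (metis length_inorder length_append length_Cons lessI add_Suc_right)
  obtain gs x y hs where **: "gaps F = gs @ x # y # hs" "gaps ?F = gs @ 2 # hs"
    "length gs = length (concat (map inorder F1) @ inorder l)"
    using gaps_forest_split[of F1 l i r F2] st F by (auto simp: extract_state_def)
  have cat: "inorder T = (concat (map inorder F1) @ inorder l) @ i # inorder r @ concat (map inorder F2)"
    using st F by (simp add: extract_state_def)
  moreover have "i \<notin> set xs" "i \<notin> set ys" using \<open>distinct (inorder T)\<close> *(1) by simp_all
  ultimately have xs: "xs = concat (map inorder F1) @ inorder l" "ys = inorder r @ concat (map inorder F2)"
    unfolding *(1) by (metis append_Cons_eq_iff)+
  have forest: "concat (map inorder (forest [l, r])) = inorder l @ inorder r"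
    by (simp add: forest_def)
  have "list_all2 (\<noteq>) (gs @ x # y # hs) (ss @ 1 # 0 # ts)"
    using st *(3) **(1) by (simp add: extract_state_def)
  then have "list_all2 (\<noteq>) (gs @ 2 # hs) (ss @ d # ts)"
    using **(3) *(5,6) xs by (simp add: list_all2_append)
  then have gaps: "list_all2 (\<noteq>) (gaps ?F) (leaf_sides 0 ?T)" using * ** by simp
  have left: "left_bst (map_tree f (Node l i r))" using st F by (simp add: extract_state_def)
  \<comment> \<open>The new trees \<open>l\<close> and \<open>r\<close> are separated by
    \<open>f i\<close>: labels in \<open>l\<close> are smaller, labels in \<open>r\<close> are at
    least \<open>f i\<close>.\<close>
  have sep: "sorted_wrt (\<lambda>s t. \<forall>x\<in>set_tree s. \<forall>y\<in>set_tree t. f x < f y) ?F"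
    using st F left by (auto simp: extract_state_def sorted_wrt_append forest_def tree.set_map
        intro: less_le_trans)
  show "extract_state f (suppress_root i F) ?T"
    unfolding root extract_state_def
  proof (intro conjI)
    show "Leaf \<notin> set ?F" using st F by (auto simp: extract_state_def forest_def)
    show "concat (map inorder ?F) = inorder ?T" using forest *(2) xs by simp
    show "sorted_wrt (<) (inorder ?T)" using st * by (auto simp: extract_state_def sorted_wrt_append)
    show "mono_on (set_tree ?T) f"
      using st set_tree_suppress_childless[of i T] by (auto simp: extract_state_def intro: mono_on_subset)
    show "right_bst (map_tree f ?T)" using st by (simp add: extract_state_def right_bst_suppress_childless)
    show "\<forall>t\<in>set ?F. left_bst (map_tree f t)" using st F left by (auto simp: extract_state_def forest_def)
  qed (fact gaps sep)+
qed

section \<open>The words read off a state\<close>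

text \<open>The P-symbol equation carried over to an intermediate state. Since the trees of a forest
  share no label, the letters belonging to a tree can be recognised by their value alone.\<close>

definition reads :: "(nat \<Rightarrow> 'a::linorder) \<Rightarrow> nat tree list \<Rightarrow> nat tree \<Rightarrow> 'a list \<Rightarrow> bool" where
  "reads f F T w \<longleftrightarrow> right_tree w = map_tree f T \<and>
     (\<forall>t\<in>set F. left_tree (filter (\<lambda>x. x \<in> f ` set_tree t) w) = map_tree f t)"

text \<open>The search tree inequalities at the ancestors of \<open>i\<close> are exactly the tests
  made by the insertion, which therefore follows the path to the suppressed node.\<close>

lemma right_insert_suppressed:
  assumes "distinct (inorder T)" "Node Leaf i Leaf \<in> subtrees T" "right_bst (map_tree f T)"
  shows "right_insert (f i) (map_tree f (suppress_childless i T)) = map_tree f T"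
  using assms
proof (induction T)
  case (Node l j r)
  consider "l = Leaf" "r = Leaf" "j = i"
    | "Node Leaf i Leaf \<in> subtrees l" | "Node Leaf i Leaf \<in> subtrees r"
    using Node.prems(2) by auto
  then show ?case
  proof cases
    case 2
    have "i \<in> set_tree l" using 2 in_set_tree_if by fastforce
    then have "i \<notin> set_tree r" "j \<noteq> i" using Node.prems(1) by auto
    then show ?thesis using 2 Node \<open>i \<in> set_tree l\<close> by (simp add: tree.set_map)
  next
    case 3
    have "i \<in> set_tree r" using 3 in_set_tree_if by fastforce
    then have "i \<notin> set_tree l" "j \<noteq> i" using Node.prems(1) by auto
    moreover have "\<not> f i \<le> f j"
      using Node.prems(3) \<open>i \<in> set_tree r\<close> by (auto simp: tree.set_map)
    ultimately show ?thesis using 3 Node by simp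
  qed simp
qed simp

text \<open>The node \<open>j\<close> is the one just created. Since right insertion turns left at
  an equal label, \<open>j\<close> precedes all other nodes labeled \<open>x\<close>; this is how
  repeated letters are told apart.\<close>

lemma right_insert_eq_map_tree:
  assumes "right_insert x s = map_tree f T" "right_bst s" "sorted_wrt (<) (inorder T)"
  shows "\<exists>j. Node Leaf j Leaf \<in> subtrees T \<and> f j = x \<and> s = map_tree f (suppress_childless j T) \<and>
    (\<forall>k\<in>set_tree T. f k = x \<longrightarrow> j \<le> k)"
  using assms
proof (induction s arbitrary: T)
  case Leaf
  then obtain j where "T = Node Leaf j Leaf" "f j = x" by (cases T) auto
  then show ?case by auto
next
  case (Node sl b sr)
  obtain l k r where T: "T = Node l k r" using Node.prems(1) by (cases T) (auto split: if_splits)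
  show ?case
  proof (cases "x \<le> b")
    case True
    then have eq: "right_insert x sl = map_tree f l" "b = f k" "sr = map_tree f r"
      using Node.prems(1) T by auto
    then obtain j where j: "Node Leaf j Leaf \<in> subtrees l" "f j = x"
      "sl = map_tree f (suppress_childless j l)" "\<forall>k\<in>set_tree l. f k = x \<longrightarrow> j \<le> k"
      using Node.IH(1)[OF eq(1)] Node.prems T by (auto simp: sorted_wrt_append)
    have "j \<in> set_tree l" using j(1) in_set_tree_if by fastforce
    then have *: "j < k" "\<forall>i\<in>set_tree r. j < i"
      using Node.prems(3) T by (auto simp: sorted_wrt_append)
    then have "j \<notin> set_tree r" by auto
    then show ?thesis using T eq j * by (intro exI[of _ j]) (auto intro: less_imp_le)
  next
    case False
    then have eq: "right_insert x sr = map_tree f r" "b = f k" "sl = map_tree f l"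
      using Node.prems(1) T by auto
    then obtain j where j: "Node Leaf j Leaf \<in> subtrees r" "f j = x"
      "sr = map_tree f (suppress_childless j r)" "\<forall>k\<in>set_tree r. f k = x \<longrightarrow> j \<le> k"
      using Node.IH(2)[OF eq(1)] Node.prems T by (auto simp: sorted_wrt_append)
    have "j \<in> set_tree r" using j(1) in_set_tree_if by fastforce
    then have *: "k < j" "\<forall>i\<in>set_tree l. i < j"
      using Node.prems(3) T by (auto simp: sorted_wrt_append)
    then have "j \<notin> set_tree l" by auto
    moreover have "\<forall>i\<in>set_tree l. f i < x" "f k < x"
      using False eq Node.prems(2) by (auto simp: tree.set_map)
    ultimately show ?thesis using T eq j * by (intro exI[of _ j]) auto
  qed
qed

text \<open>The left search tree keeps equal labels to the right, and the other trees have only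
  labels smaller or larger than \<open>f i\<close>.\<close>

lemma same_label_as_root:
  assumes st: "extract_state f (F1 @ Node l i r # F2) T" and k: "k \<in> set_tree T" "f k = f i"
  shows "k = i \<or> k \<in> set_tree r"
proof -
  have left: "left_bst (map_tree f (Node l i r))" using st by (simp add: extract_state_def)
  have "sorted_wrt (\<lambda>s t. \<forall>x\<in>set_tree s. \<forall>y\<in>set_tree t. f x < f y) (F1 @ Node l i r # F2)"
    using st by (simp add: extract_state_def)
  then have "k \<notin> (\<Union>t\<in>set (F1 @ F2). set_tree t)"
    using k(2) by (fastforce simp: sorted_wrt_append)
  then have "k \<in> set_tree (Node l i r)" using k(1) extract_state_set[OF st] by auto
  moreover have "k \<notin> set_tree l" using left k(2) by (auto simp: tree.set_map)
  ultimately show ?thesis by auto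
qed

lemma root_least_index:
  assumes st: "extract_state f (F1 @ Node l i r # F2) T" and k: "k \<in> set_tree T" "f k = f i"
  shows "i \<le> k"
proof -
  have "sorted_wrt (<) (concat (map inorder (F1 @ Node l i r # F2)))"
    using st by (simp add: extract_state_def)
  then have "\<forall>j\<in>set_tree r. i < j" by (simp add: sorted_wrt_append)
  then show ?thesis using same_label_as_root[OF st k] by auto
qed

text \<open>In the tree rooted at \<open>i\<close>, the letters after \<open>f i\<close> split into
  those below it, which belong to \<open>l\<close>, and the others, which belong to
  \<open>r\<close>. The other trees do not see the letter \<open>f i\<close>.\<close>

lemma reads_forest_step:
  assumes st: "extract_state f (F1 @ Node l i r # F2) T" and w: "set w \<subseteq> f ` (set_tree T - {i})"
  shows "(\<forall>t\<in>set (F1 @ Node l i r # F2).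
        left_tree (filter (\<lambda>x. x \<in> f ` set_tree t) (f i # w)) = map_tree f t) \<longleftrightarrow>
    (\<forall>t\<in>set (F1 @ forest [l, r] @ F2). left_tree (filter (\<lambda>x. x \<in> f ` set_tree t) w) = map_tree f t)"
    (is "(\<forall>t\<in>_. ?P (f i # w) t) \<longleftrightarrow> (\<forall>t\<in>_. ?P w t)")
proof -
  have left: "left_bst (map_tree f (Node l i r))" using st by (simp add: extract_state_def)
  have "sorted_wrt (\<lambda>s t. \<forall>x\<in>set_tree s. \<forall>y\<in>set_tree t. f x < f y) (F1 @ Node l i r # F2)"
    using st by (simp add: extract_state_def)
  then have "f i \<notin> f ` set_tree t" if "t \<in> set F1 \<union> set F2" for t
    using that by (fastforce simp: sorted_wrt_append)
  then have other: "?P (f i # w) t \<longleftrightarrow> ?P w t" if "t \<in> set F1 \<union> set F2" for t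
    using that by auto
  \<comment> \<open>A further occurrence of \<open>f i\<close> in \<open>w\<close> is the label of a
    node other than \<open>i\<close>, which then lies in \<open>r\<close>; hence the letters that
    are at least \<open>f i\<close> are letters of \<open>r\<close>.\<close>
  have "f i \<in> set w \<Longrightarrow> f i \<in> f ` set_tree r"
    using w same_label_as_root[OF st] by fastforce
  then have "filter (\<lambda>y. y < f i) (filter (\<lambda>x. x \<in> f ` set_tree (Node l i r)) w) =
      filter (\<lambda>x. x \<in> f ` set_tree l) w"
    "filter (\<lambda>y. f i \<le> y) (filter (\<lambda>x. x \<in> f ` set_tree (Node l i r)) w) =
      filter (\<lambda>x. x \<in> f ` set_tree r) w"
    using left unfolding filter_filter by (fastforce intro!: filter_cong simp: tree.set_map)+
  moreover have "filter (\<lambda>x. x \<in> f ` set_tree (Node l i r)) (f i # w) =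
      f i # filter (\<lambda>x. x \<in> f ` set_tree (Node l i r)) w"
    by simp
  ultimately have "?P (f i # w) (Node l i r) \<longleftrightarrow> ?P w l \<and> ?P w r"
    by (simp only: left_tree_Cons tree.map tree.inject simp_thms)
  moreover have "(\<forall>t\<in>set (forest [l, r]). ?P w t) \<longleftrightarrow> ?P w l \<and> ?P w r"
    by (auto simp: forest_def)
  ultimately show ?thesis using other by (auto simp del: filter.simps)
qed

lemma reads_suppressed_set:
  assumes "extract_state f F T" "i \<in> candidates F T" "right_tree w = map_tree f (suppress_childless i T)"
  shows "set w \<subseteq> f ` (set_tree T - {i})"
proof -
  have "Node Leaf i Leaf \<in> subtrees T" using assms(2) by (simp add: candidates_def)
  moreover have "distinct (inorder T)" using assms(1) by (simp add: extract_state_def strict_sorted_iff)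
  ultimately obtain xs ys where "inorder T = xs @ i # ys"
    "inorder (suppress_childless i T) = xs @ ys"
    using suppress_childless_split[of T i 0] by auto
  then have "set_tree (suppress_childless i T) = set_tree T - {i}"
    using \<open>distinct (inorder T)\<close> by (auto simp flip: set_inorder)
  then show ?thesis using assms(3) by (metis set_tree_right_tree tree.set_map order_refl)
qed

lemma reads_Cons:
  assumes st: "extract_state f F T" and i: "i \<in> candidates F T"
    and w: "reads f (suppress_root i F) (suppress_childless i T) w"
  shows "reads f F T (f i # w)"
proof -
  obtain F1 l r F2 where F: "F = F1 @ Node l i r # F2" and leaf: "Node Leaf i Leaf \<in> subtrees T"
    using candidatesE[OF i] .
  have R: "right_tree w = map_tree f (suppress_childless i T)" using w by (simp add: reads_def)
  have "right_tree (f i # w) = map_tree f T"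
    using right_insert_suppressed[OF _ leaf, of f] st R
    by (simp add: right_tree_Cons extract_state_def strict_sorted_iff)
  moreover have "suppress_root i F = F1 @ forest [l, r] @ F2"
    using extract_state_suppress_root st F by blast
  ultimately show ?thesis
    using w reads_forest_step[of f F1 l i r F2 T w] st reads_suppressed_set[OF st i R]
    unfolding reads_def F by simp
qed

text \<open>The first letter \<open>x\<close> of \<open>v\<close> labels a root \<open>i\<close> of
  the forest and, being inserted last into the right tree, a childless node \<open>j\<close> of
  \<open>T\<close>. Both are the least index labeled \<open>x\<close>, so they coincide and form a
  candidate.\<close>

lemma reads_ConsE:
  assumes st: "extract_state f F T" and "F \<noteq> []" and v: "reads f F T v"
  obtains i w where "i \<in> candidates F T" "v = f i # w"
    "reads f (suppress_root i F) (suppress_childless i T) w"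
proof -
  have R: "right_tree v = map_tree f T" using v by (simp add: reads_def)
  have "inorder T \<noteq> []" using assms unfolding extract_state_def by (cases F) (auto split: tree.splits)
  then have "v \<noteq> []" using R by (cases T) auto
  then obtain x w where vx: "v = x # w" by (cases v) auto
  have "x \<in> f ` set_tree T" using R vx by (metis list.set_intros(1) set_tree_right_tree tree.set_map)
  then obtain t where t: "t \<in> set F" "x \<in> f ` set_tree t" using extract_state_set[OF st] by auto
  have "left_tree (filter (\<lambda>x. x \<in> f ` set_tree t) (x # w)) = map_tree f t"
    using v t(1) vx by (auto simp: reads_def)
  then have "left_tree (x # filter (\<lambda>x. x \<in> f ` set_tree t) w) = map_tree f t" using t(2) by simp
  then obtain l i r where t': "t = Node l i r" "f i = x"
    by (cases t) (auto simp: left_tree_Cons)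
  obtain F1 F2 where F: "F = F1 @ Node l i r # F2" using t t' by (metis split_list)
  have "right_insert x (right_tree w) = map_tree f T" using R vx by (simp add: right_tree_Cons)
  moreover have "sorted_wrt (<) (inorder T)" using st by (simp add: extract_state_def)
  ultimately obtain j where j: "Node Leaf j Leaf \<in> subtrees T" "f j = x"
    "right_tree w = map_tree f (suppress_childless j T)" "\<forall>k\<in>set_tree T. f k = x \<longrightarrow> j \<le> k"
    using right_insert_eq_map_tree[OF _ right_bst_right_tree] by blast
  have "i \<in> set_tree T" using F extract_state_set[OF st] by auto
  moreover have "j \<in> set_tree T" using j(1) in_set_tree_if by fastforce
  ultimately have "i = j"
    using j(2,4) t'(2) root_least_index[of f F1 l i r F2 T j] st F by (auto intro: antisym)
  then have i: "i \<in> candidates F T" and R': "right_tree w = map_tree f (suppress_childless i T)"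
    using j F by (auto simp: candidates_def)
  have "suppress_root i F = F1 @ forest [l, r] @ F2"
    using extract_state_suppress_root st F by blast
  then have "reads f (suppress_root i F) (suppress_childless i T) w"
    using v vx t'(2) R' reads_forest_step[of f F1 l i r F2 T w] st reads_suppressed_set[OF st i R']
    unfolding reads_def F by simp
  then show ?thesis using that i vx t'(2) by blast
qed

section \<open>The greedy choice among the candidates\<close>

lemma candidates_subset: "candidates F T \<subseteq> set_tree T"
  by (auto simp: candidates_def dest: in_set_tree_if)

lemma candidates_inj:
  assumes st: "extract_state f F T" and "i \<in> candidates F T" "j \<in> candidates F T" "f i = f j"
  shows "i = j"
proof -
  have "k \<le> m" if k: "k \<in> candidates F T" and m: "m \<in> candidates F T" "f k = f m" for k m
  proof -
    obtain F1 l r F2 where "F = F1 @ Node l k r # F2" using k by (rule candidatesE)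
    moreover have "m \<in> set_tree T" using m(1) candidates_subset by blast
    ultimately show ?thesis using root_least_index[of f F1 l k r F2 T m] st m(2) by simp
  qed
  then show ?thesis using assms by (simp add: antisym)
qed

text \<open>The order is kept abstract as \<open>E\<close> in order to serve both algorithms. Every
  word read off the state starts with the label of a candidate: either this label differs from the
  picked one and decides the comparison, or the index is the same and the tails are compared in the
  same next state.\<close>

lemma extract_loop_extremal:
  fixes lab :: "'a::linorder list" and E :: "'a list \<Rightarrow> 'a list \<Rightarrow> bool"
  assumes f: "\<And>i. f i = lab ! (i - 1)"
    and pick: "\<And>S. finite S \<Longrightarrow> S \<noteq> {} \<Longrightarrow> pick S \<in> S"
    and E_Nil: "E [] []"
    and E_Cons: "\<And>x w v. E w v \<Longrightarrow> E (x # w) (x # v)"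
    and E_pick: "\<And>S j w v. finite S \<Longrightarrow> j \<in> S \<Longrightarrow> mono_on S f \<Longrightarrow> f (pick S) \<noteq> f j \<Longrightarrow>
      E (f (pick S) # w) (f j # v)"
    and st: "extract_state f F T"
  shows "\<exists>w. extract_loop pick lab u F T = Some (u @ w) \<and> reads f F T w \<and>
    (\<forall>v. reads f F T v \<longrightarrow> E w v)"
  using st
proof (induction "size T" arbitrary: F T u rule: less_induct)
  case less
  show ?case
  proof (cases "F = []")
    case True
    then have "T = Leaf" using less.prems by (simp add: extract_state_def)
    moreover have "v = []" if "right_tree v = Leaf" for v :: "'a list"
      using that by (metis mset_right_tree inorder.simps(1) mset_zero_iff mset.simps(1))
    ultimately show ?thesis using True E_Nil
      by (intro exI[of _ "[]"]) (auto simp: extract_loop.simps reads_def)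
  next
    case False
    let ?C = "candidates F T" and ?i = "pick (candidates F T)"
    have fin: "finite ?C" using candidates_subset by (rule finite_subset) simp
    have ne: "?C \<noteq> {}" using candidates_nonempty less.prems False by blast
    have i: "?i \<in> ?C" using pick fin ne by blast
    note step = extract_state_step[OF less.prems i]
    obtain w where w:
      "extract_loop pick lab (u @ [f ?i]) (suppress_root ?i F) (suppress_childless ?i T) =
        Some ((u @ [f ?i]) @ w)"
      "reads f (suppress_root ?i F) (suppress_childless ?i T) w"
      "\<And>v. reads f (suppress_root ?i F) (suppress_childless ?i T) v \<Longrightarrow> E w v"
      using less.hyps[OF step(2,1)] by blast
    have "T \<noteq> Leaf" using candidates_subset ne by fastforce
    then have "extract_loop pick lab u F T = Some (u @ f ?i # w)"
      using False ne w(1) by (subst extract_loop.simps) (simp add: Let_def f)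
    moreover have "reads f F T (f ?i # w)" using reads_Cons[OF less.prems i w(2)] .
    moreover have "E (f ?i # w) v" if v: "reads f F T v" for v
    proof -
      obtain j v' where j: "j \<in> ?C" "v = f j # v'"
        "reads f (suppress_root j F) (suppress_childless j T) v'"
        using reads_ConsE[OF less.prems False v] .
      show ?thesis
      proof (cases "f ?i = f j")
        case True
        then have "?i = j" using candidates_inj[OF less.prems i j(1)] by simp
        then show ?thesis using w(3) j E_Cons by simp
      next
        case False
        moreover have "mono_on ?C f"
          using less.prems candidates_subset unfolding extract_state_def by (blast intro: mono_on_subset)
        ultimately show ?thesis using E_pick fin j by simp
      qed
    qed
    ultimately show ?thesis by blast
  qed
qed

section \<open>The initial state\<close>

lemma inorder_index_from: "inorder (index_from k t) = [k..<k + size t]"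
proof (induction t arbitrary: k)
  case (Node l x r)
  have "[k..<k + size (Node l x r)] = [k..<k + size l] @ [k + size l..<k + size l + Suc (size r)]"
    using upt_add_eq_append[of k "k + size l" "Suc (size r)"] by (simp add: add.assoc)
  also have "[k + size l..<k + size l + Suc (size r)] = (k + size l) # [k + size l + 1..<k + size l + 1 + size r]"
    by (subst upt_conv_Cons) auto
  finally show ?case using Node by simp
qed simp

lemma leaf_sides_index_from [simp]: "leaf_sides d (index_from k t) = leaf_sides d t"
  by (induction t arbitrary: d k) auto

lemma canopy_index_from [simp]: "canopy (index_from k t) = canopy t"
  by (simp add: canopy_def)

lemma index_from_eq_Leaf [simp]: "index_from k t = Leaf \<longleftrightarrow> t = Leaf"
  by (cases t) auto

lemma map_index_from:
  assumes "\<And>j. j < size t \<Longrightarrow> f (k + j) = inorder t ! j"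
  shows "map_tree f (index_from k t) = t"
  using assms
proof (induction t arbitrary: k)
  case (Node l x r)
  have "map_tree f (index_from k l) = l"
    using Node.prems by (intro Node.IH) (simp add: nth_append less_SucI)
  moreover have "map_tree f (index_from (k + size l + 1) r) = r"
  proof (rule Node.IH(2))
    fix j assume "j < size r"
    then show "f (k + size l + 1 + j) = inorder r ! j"
      using Node.prems[of "size l + 1 + j"] by (simp add: nth_append add.assoc)
  qed
  moreover have "f (k + size l) = x"
    using Node.prems[of "size l"] by (simp add: nth_append)
  ultimately show ?case by simp
qed simp

lemma sorted_inorder_left_bst: "left_bst t \<Longrightarrow> sorted (inorder t)"
proof (induction t)
  case (Node l x r)
  then show ?case by (auto simp: sorted_append intro: less_imp_le less_le_trans)
qed simp

context
  fixes TL TR :: "'a::linorder tree" and f :: "nat \<Rightarrow> 'a"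
  assumes twin: "twin_bst TL TR"
  defines "f \<equiv> \<lambda>i. inorder TL ! (i - 1)"
begin

lemma twin_bst_index: "map_tree f (index_from 1 TL) = TL" "map_tree f (index_from 1 TR) = TR"
  using twin by (simp_all add: map_index_from f_def twin_bst_def)

lemma twin_bst_extract_state: "extract_state f (forest [index_from 1 TL]) (index_from 1 TR)"
proof -
  have size: "size TL = size TR" and can: "list_all2 (\<noteq>) (canopy TL) (canopy TR)"
    using twin by (auto simp: twin_bst_def twin_trees_def)
  have "set_tree (index_from 1 TR) = {1..<1 + size TR}"
    by (simp only: inorder_index_from set_upt flip: set_inorder)
  moreover have "sorted (inorder TL)"
    by (rule sorted_inorder_left_bst) (use twin in \<open>simp add: twin_bst_def\<close>)
  ultimately have mono: "mono_on (set_tree (index_from 1 TR)) f"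
    using size by (auto simp: f_def intro!: mono_onI sorted_nth_mono)
  have "list_all2 (\<noteq>) (gaps (forest [index_from 1 TL])) (leaf_sides 0 (index_from 1 TR))"
  proof (cases "TL = Leaf")
    case False
    then have "TR \<noteq> Leaf" using size by auto
    \<comment> \<open>Here \<open>2 # canopy TL\<close> followed by \<open>2\<close> faces
      \<open>1 # canopy TR\<close> followed by \<open>0\<close>, so only the twin condition is left
      to use.\<close>
    then show ?thesis using False can
      by (simp add: forest_def gaps_Cons leaf_sides_canopy list_all2_appendI)
  qed (use size in \<open>simp add: forest_def\<close>)
  moreover have "sorted_wrt (<) (inorder (index_from 1 TR))"
    unfolding inorder_index_from by (rule sorted_wrt_upt)
  moreover have "inorder (index_from 1 TL) = inorder (index_from 1 TR)"
    unfolding inorder_index_from size ..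
  ultimately show ?thesis
    using mono twin twin_bst_index unfolding extract_state_def twin_bst_def forest_def
    by (cases "TL = Leaf") (simp_all add: eq_commute[of Leaf])
qed

text \<open>At the start the only tree of the forest contains all labels, so filtering by its labels
  leaves \<open>w\<close> unchanged.\<close>

lemma twin_bst_reads:
  "reads f (forest [index_from 1 TL]) (index_from 1 TR) w \<longleftrightarrow> P_symbol w = (TL, TR)"
proof -
  have set: "f ` set_tree (index_from 1 TL) = set_tree TL" "set_tree TL = set_tree TR"
    using twin_bst_index twin by (metis tree.set_map, metis twin_bst_def set_inorder)
  have all: "filter (\<lambda>x. x \<in> f ` set_tree (index_from 1 TL)) w = w" if "right_tree w = TR"
    using that set by (metis filter_True set_tree_right_tree)
  show ?thesis
  proof (cases "TL = Leaf")
    case True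
    then have "TR = Leaf" using twin by (auto simp: twin_bst_def twin_trees_def)
    moreover have "w = []" if "right_tree w = Leaf"
      using that by (metis mset_right_tree inorder.simps(1) mset_zero_iff mset.simps(1))
    ultimately show ?thesis using True
      by (auto simp: reads_def forest_def P_symbol_eq_iff)
  next
    case False
    then show ?thesis using all twin_bst_index
      by (auto simp: reads_def forest_def P_symbol_eq_iff)
  qed
qed

lemma twin_bst_extremal:
  assumes "\<And>S. finite S \<Longrightarrow> S \<noteq> {} \<Longrightarrow> pick S \<in> S"
    and "E [] []"
    and "\<And>x w v. E w v \<Longrightarrow> E (x # w) (x # v)"
    and "\<And>S j w v. finite S \<Longrightarrow> j \<in> S \<Longrightarrow> mono_on S f \<Longrightarrow> f (pick S) \<noteq> f j \<Longrightarrow>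
      E (f (pick S) # w) (f j # v)"
  shows "\<exists>w. extract_loop pick (inorder TL) [] (forest [index_from 1 TL]) (index_from 1 TR) = Some w \<and>
    P_symbol w = (TL, TR) \<and> (\<forall>v. P_symbol v = (TL, TR) \<longrightarrow> E w v)"
proof -
  have "f i = inorder TL ! (i - 1)" for i by (simp add: f_def)
  from extract_loop_extremal[where E = E and pick = pick, OF this assms twin_bst_extract_state, of "[]"]
  show ?thesis unfolding twin_bst_reads append_Nil .
qed

text \<open>Labels increase weakly with the index, so the smallest eligible index carries the
  smallest eligible label.\<close>

lemma extract_min_lex_least:
  "\<exists>w. extract_min TL TR = Some w \<and> P_symbol w = (TL, TR) \<and>
    (\<forall>v. P_symbol v = (TL, TR) \<longrightarrow> lexordp_eq w v)"
  unfolding extract_min_def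
proof (rule twin_bst_extremal)
  fix S j and w v :: "'a list"
  assume S: "finite S" "j \<in> S" "mono_on S f" "f (Min S) \<noteq> f j"
  have "f (Min S) \<le> f j" using S(1,2) Min_in[of S] by (intro mono_onD[OF S(3)]) (metis empty_iff, simp_all)
  then show "lexordp_eq (f (Min S) # w) (f j # v)" using S(4) by (simp add: less_le)
qed auto

lemma extract_max_lex_greatest:
  "\<exists>w. extract_max TL TR = Some w \<and> P_symbol w = (TL, TR) \<and>
    (\<forall>v. P_symbol v = (TL, TR) \<longrightarrow> lexordp_eq v w)"
  unfolding extract_max_def
proof (rule twin_bst_extremal[where E = "\<lambda>w v. lexordp_eq v w"])
  fix S j and w v :: "'a list"
  assume S: "finite S" "j \<in> S" "mono_on S f" "f (Max S) \<noteq> f j"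
  have "f j \<le> f (Max S)" using S(1,2) Max_in[of S] by (intro mono_onD[OF S(3)]) (simp, metis empty_iff, simp)
  then show "lexordp_eq (f j # v) (f (Max S) # w)" using S(4) by (simp add: less_le)
qed auto

end

section \<open>Permutations and the extremal words of a class\<close>

lemma P_symbol_is_permutation:
  assumes "labeled_by_permutation A TL TR" "P_symbol w = (TL, TR)"
  shows "is_permutation A (size TL) w"
proof -
  have "mset w = mset (inorder TL)" using assms(2) by (metis P_symbol_eq_iff mset_left_tree)
  then show ?thesis using assms(1) unfolding labeled_by_permutation_def is_permutation_def
    by (metis mset_eq_imp_distinct_iff mset_eq_length mset_eq_setD)
qed

theorem proposition4p16:
  fixes A :: "nat \<Rightarrow> 'a::linorder" and TL TR :: "'a tree"
  assumes "alphabet A"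
    and "twin_bst TL TR"
  shows "(\<exists>w. extract_min TL TR = Some w \<and>
           is_least lexordp_eq (encoded_class TL TR) w \<and>
           (labeled_by_permutation A TL TR \<longrightarrow>
              is_permutation A (size TL) w \<and>
              is_least (permutohedron_le A (size TL)) (encoded_class TL TR) w)) \<and>
         (\<exists>w. extract_max TL TR = Some w \<and>
           is_greatest lexordp_eq (encoded_class TL TR) w \<and>
           (labeled_by_permutation A TL TR \<longrightarrow>
              is_permutation A (size TL) w \<and>
              is_greatest (permutohedron_le A (size TL)) (encoded_class TL TR) w))"
proof -
  obtain m where m: "extract_min TL TR = Some m" "P_symbol m = (TL, TR)"
    and m_least: "\<And>v. P_symbol v = (TL, TR) \<Longrightarrow> lexordp_eq m v"
    using extract_min_lex_least[OF assms(2)] by blast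
  obtain M where M: "extract_max TL TR = Some M" "P_symbol M = (TL, TR)"
    and M_greatest: "\<And>v. P_symbol v = (TL, TR) \<Longrightarrow> lexordp_eq v M"
    using extract_max_lex_greatest[OF assms(2)] by blast
  have cls: "encoded_class TL TR = {v. P_symbol v = (TL, TR)}"
    using encoded_class_eq[OF m(2) m_least] .
  have "permutohedron_le A (size TL) m v \<and> permutohedron_le A (size TL) v M"
    if A: "labeled_by_permutation A TL TR" and v: "P_symbol v = (TL, TR)" for v
  proof
    \<comment> \<open>Lexicographic extremality turns into extremality in the permutohedron, because
      the flips joining \<open>v\<close> to \<open>m\<close> and to \<open>M\<close> are
      covers.\<close>
    have "flip\<^sup>*\<^sup>* m v" using v m(2) m_least by (simp add: flips_from_lex_min)
    then show "permutohedron_le A (size TL) m v"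
      by (rule flips_permutohedron_le[OF _ P_symbol_is_permutation[OF A m(2)]])
    have "flip\<^sup>*\<^sup>* v M" using v M(2) M_greatest by (simp add: flips_to_lex_max)
    then show "permutohedron_le A (size TL) v M"
      by (rule flips_permutohedron_le[OF _ P_symbol_is_permutation[OF A v]])
  qed
  then show ?thesis
    using m M m_least M_greatest P_symbol_is_permutation
    by (auto simp: cls is_least_def is_greatest_def)
qed

end
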